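(* Let $N, C\in\mathbb{N}_+$, let $P\in\mathbb{R}^{N\times N}$ be a symmetric matrix, and let $U\subset\mathbb{R}^N$ be an $M$-dimensional subspace ($M\le N$) such that (1) $U$ has an orthonormal basis $(e_m)_{m\in[M]}$ consisting of non-negative vectors, and (2) $U$ is invariant under $P$. Let $\lambda$ be the operator norm of $P|_{U^\perp}:U^\perp\to U^\perp$. For each $l\in\mathbb{N}_+$ let $H_l\in\mathbb{N}_+$, let $W_{lh}\in\mathbb{R}^{C\times C}$ for $h\in[H_l]$, let $s_{lh}$ be the maximum singular value of $W_{lh}$, let $s_l:=\prod_{h=1}^{H_l}s_{lh}$, and let $f_l(X):=\mathrm{MLP}_l(PX)$. Let $s:=\sup_{l\in\mathbb{N}_+}s_l$ and assume $s<\infty$. For an initial value $X^{(0)}\in\mathbb{R}^{N\times C}$ let $X^{(l)}:=f_l(X^{(l-1)})$ for $l\ge 1$. Let $\mathcal{M}:=U\otimes\mathbb{R}^C$. Then $d_{\mathcal{M}}(X^{(l)})=O((s\lambda)^l)$ as $l\to\infty$. In particular, if $s\lambda<1$, then for any initial value $X^{(0)}$, $X^{(l)}$ exponentially approaches $\mathcal{M}$ as $l\to\infty$ (i.e. $d_{\mathcal{M}}(X^{(l)})\to0$ exponentially fast).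
   Context: Notation: $[N]=\{1,\dots,N\}$. A vector is non-negative if all its entries are $\ge 0$. $\sigma$ is the element-wise ReLU, $\sigma(X)_{nc}=\max(X_{nc},0)$. The map $\mathrm{MLP}_l:\mathbb{R}^{N\times C}\to\mathbb{R}^{N\times C}$ is $\mathrm{MLP}_l(X):=\sigma(\cdots\sigma(\sigma(X)W_{l1})W_{l2}\cdots W_{lH_l})$, i.e. $\mathrm{MLP}_l(X)=Z_{H_l}$ where $Z_0=\sigma(X)$ and $Z_h=\sigma(Z_{h-1}W_{lh})$ for $h=1,\dots,H_l$. $U^\perp$ is the orthogonal complement of $U$; it is $P$-invariant because $P$ is symmetric. $(v\otimes w)_{nc}=v_nw_c$ and $U\otimes\mathbb{R}^C=\{\sum_{m=1}^M e_m\otimes w_m\mid w_m\in\mathbb{R}^C\}$. $d_{\mathcal{M}}(X):=\inf\{\|X-Y\|_{\mathrm F}\mid Y\in\mathcal{M}\}$ with $\|\cdot\|_{\mathrm F}$ the Frobenius norm. *)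

theory Defs
  imports "HOL-Analysis.Analysis" "HOL-Library.Landau_Symbols"
begin

text \<open>
  An \<open>N \<times> C\<close> matrix is an element of \<open>real ^ 'c ^ 'n\<close> (rows indexed by \<open>'n\<close>). The library norm on
  this type is the Frobenius norm, so \<open>infdist\<close> is the Frobenius distance to a (nonempty) set.
\<close>

lemma norm_matrix_eq_frobenius:
  fixes X :: "real ^ 'c ^ 'n"
  shows "norm X = sqrt (\<Sum>n\<in>UNIV. \<Sum>c\<in>UNIV. (X $ n $ c)\<^sup>2)"
  by (simp add: norm_vec_def L2_set_def sum_nonneg)

definition relu :: "real ^ 'c ^ 'n \<Rightarrow> real ^ 'c ^ 'n" where
  "relu X = (\<chi> n c. max (X $ n $ c) 0)"

text \<open>\<open>mlp W h X\<close> is the result of \<open>h\<close> weight layers \<open>W 1, \<dots>, W h\<close>; \<open>W 0\<close> is never used.\<close>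

primrec mlp :: "(nat \<Rightarrow> real ^ 'c ^ 'c) \<Rightarrow> nat \<Rightarrow> real ^ 'c ^ 'n \<Rightarrow> real ^ 'c ^ 'n" where
  "mlp W 0 X = relu X"
| "mlp W (Suc h) X = relu (mlp W h X ** W (Suc h))"

definition layer ::
    "real ^ 'n ^ 'n \<Rightarrow> (nat \<Rightarrow> nat) \<Rightarrow> (nat \<Rightarrow> nat \<Rightarrow> real ^ 'c ^ 'c) \<Rightarrow> nat
      \<Rightarrow> real ^ 'c ^ 'n \<Rightarrow> real ^ 'c ^ 'n" where
  "layer P H W l X = mlp (W l) (H l) (P ** X)"

primrec layer_output ::
    "real ^ 'n ^ 'n \<Rightarrow> (nat \<Rightarrow> nat) \<Rightarrow> (nat \<Rightarrow> nat \<Rightarrow> real ^ 'c ^ 'c) \<Rightarrow> real ^ 'c ^ 'n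
      \<Rightarrow> nat \<Rightarrow> real ^ 'c ^ 'n" where
  "layer_output P H W X0 0 = X0"
| "layer_output P H W X0 (Suc l) = layer P H W (Suc l) (layer_output P H W X0 l)"

definition singular_values :: "real ^ 'm ^ 'n \<Rightarrow> real set" where
  "singular_values A =
     {r. r \<ge> 0 \<and> (\<exists>v. v \<noteq> 0 \<and> (transpose A ** A) *v v = r\<^sup>2 *\<^sub>R v)}"

definition max_singular_value :: "real ^ 'm ^ 'n \<Rightarrow> real" where
  "max_singular_value A = Max (singular_values A)"

text \<open>
  Operator norm of the restriction of \<open>f\<close> to a subspace \<open>S\<close>, mirroring \<^const>\<open>onorm\<close>.
  The summand at \<open>0 \<in> S\<close> is \<open>0 / 0 = 0\<close>, so the value is \<open>0\<close> when \<open>S = {0}\<close>.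
\<close>

definition onorm_on ::
    "'a::real_normed_vector set \<Rightarrow> ('a \<Rightarrow> 'b::real_normed_vector) \<Rightarrow> real" where
  "onorm_on S f = (SUP x\<in>S. norm (f x) / norm x)"

definition tensor :: "real ^ 'n \<Rightarrow> real ^ 'c \<Rightarrow> real ^ 'c ^ 'n" where
  "tensor v w = (\<chi> n c. v $ n * w $ c)"

definition tensor_space :: "nat \<Rightarrow> (nat \<Rightarrow> real ^ 'n) \<Rightarrow> (real ^ 'c ^ 'n) set" where
  "tensor_space M e = {\<Sum>m=1..M. tensor (e m) (w m) | w. True}"

definition nonneg_vec :: "real ^ 'n \<Rightarrow> bool" where
  "nonneg_vec v \<longleftrightarrow> (\<forall>n. v $ n \<ge> 0)"

definition orthonormal_basis :: "nat \<Rightarrow> (nat \<Rightarrow> 'a::euclidean_space) \<Rightarrow> 'a set \<Rightarrow> bool" where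
  "orthonormal_basis M e U \<longleftrightarrow>
     (\<forall>i\<in>{1..M}. \<forall>j\<in>{1..M}. e i \<bullet> e j = (if i = j then 1 else 0)) \<and>
     span (e ` {1..M}) = U"

definition exponentially_approaches ::
    "(nat \<Rightarrow> 'a::metric_space) \<Rightarrow> 'a set \<Rightarrow> bool" where
  "exponentially_approaches X S \<longleftrightarrow>
     (\<exists>\<rho>::real. 0 < \<rho> \<and> \<rho> < 1 \<and> (\<lambda>l. infdist (X l) S) \<in> O(\<lambda>l. \<rho> ^ l))"

lemma exponentially_approaches_imp_tendsto:
  assumes "exponentially_approaches X S"
  shows "(\<lambda>l. infdist (X l) S) \<longlonglongrightarrow> 0"
proof -
  obtain \<rho> :: real where \<rho>: "0 < \<rho>" "\<rho> < 1" "(\<lambda>l. infdist (X l) S) \<in> O(\<lambda>l. \<rho> ^ l)"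
    using assms unfolding exponentially_approaches_def by blast
  from \<rho>(3) obtain c where "eventually (\<lambda>l. norm (infdist (X l) S) \<le> c * norm (\<rho> ^ l)) at_top"
    by (elim landau_o.bigE)
  moreover have "(\<lambda>l. c * norm (\<rho> ^ l)) \<longlonglongrightarrow> 0"
    using \<rho>(1,2) by (auto intro!: tendsto_mult_right_zero tendsto_norm_zero LIMSEQ_power_zero)
  ultimately show ?thesis
    by (rule Lim_null_comparison)
qed

end

theory Submission
  imports Defs
begin

text \<open>
  Let \<open>d\<close> be the distance to \<open>U \<otimes> \<real>\<^sup>C\<close>. Multiplication by \<open>P\<close> from the left contracts \<open>d\<close> by the
  factor \<open>\<lambda>\<close>, since the columns of the residual of the orthogonal projection lie in the orthogonal
  complement of \<open>U\<close>; multiplication by \<open>W\<close> from the right preserves \<open>U \<otimes> \<real>\<^sup>C\<close> and contracts \<open>d\<close>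
  by the largest singular value of \<open>W\<close>. For the ReLU write \<open>X = X\<^sup>+ - X\<^sup>-\<close> and use
  \<open>d(X)\<^sup>2 = \<parallel>X\<parallel>\<^sup>2 - (\<Sum>m. \<parallel>X\<^sup>T e\<^sub>m\<parallel>\<^sup>2)\<close>: the cross terms of \<open>X\<^sup>+\<close> and \<open>X\<^sup>-\<close> have a favourable sign because the
  \<open>e\<^sub>m\<close> are non-negative, and what remains is \<open>d(X\<^sup>-)\<^sup>2 \<ge> 0\<close>. Hence each layer contracts \<open>d\<close> by \<open>s \<lambda>\<close>.
\<close>

section \<open>The largest singular value\<close>

text \<open>Eigenvectors of a symmetric matrix for distinct eigenvalues are orthogonal, so choosing
  one per eigenvalue gives an independent set. Finiteness matters because
  \<open>max_singular_value\<close> is a \<open>Max\<close>.\<close>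

lemma finite_eigenvalues_symmetric:
  fixes A :: "real ^ 'n ^ 'n"
  assumes "transpose A = A"
  shows "finite {\<mu>. \<exists>v. v \<noteq> 0 \<and> A *v v = \<mu> *\<^sub>R v}" (is "finite ?E")
proof -
  have "\<forall>\<mu>\<in>?E. \<exists>v. v \<noteq> 0 \<and> A *v v = \<mu> *\<^sub>R v" by simp
  from bchoice[OF this] obtain f
    where f: "\<And>\<mu>. \<mu> \<in> ?E \<Longrightarrow> f \<mu> \<noteq> 0 \<and> A *v f \<mu> = \<mu> *\<^sub>R f \<mu>" by blast
  have orth: "f \<mu> \<bullet> f \<nu> = 0" if "\<mu> \<in> ?E" "\<nu> \<in> ?E" "\<mu> \<noteq> \<nu>" for \<mu> \<nu>
  proof -
    have "(A *v f \<mu>) \<bullet> f \<nu> = f \<mu> \<bullet> (A *v f \<nu>)"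
      by (metis assms dot_lmul_matrix transpose_matrix_vector)
    then have "(\<mu> - \<nu>) * (f \<mu> \<bullet> f \<nu>) = 0"
      using f[OF that(1)] f[OF that(2)] by (simp add: algebra_simps)
    then show ?thesis using that by simp
  qed
  have inj: "inj_on f ?E"
  proof (rule inj_onI, rule ccontr)
    fix \<mu> \<nu> assume E: "\<mu> \<in> ?E" "\<nu> \<in> ?E" and eq: "f \<mu> = f \<nu>" and "\<mu> \<noteq> \<nu>"
    then have "f \<mu> \<bullet> f \<mu> = 0" using orth[OF E] by simp
    then show False using f[OF E(1)] by simp
  qed
  have "pairwise orthogonal (f ` ?E)"
    unfolding pairwise_def orthogonal_def using orth by blast
  moreover have "0 \<notin> f ` ?E" using f by force
  ultimately have "independent (f ` ?E)" by (rule pairwise_orthogonal_independent)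
  then have "finite (f ` ?E)" by (rule independent_imp_finite)
  then show ?thesis using inj finite_imageD by blast
qed

lemma finite_singular_values: "finite (singular_values A)"
proof (rule finite_subset)
  let ?E = "{\<mu>. \<exists>v. v \<noteq> 0 \<and> (transpose A ** A) *v v = \<mu> *\<^sub>R v}"
  show "singular_values A \<subseteq> sqrt ` ?E"
  proof
    fix r assume "r \<in> singular_values A"
    then have "r\<^sup>2 \<in> ?E" "r = sqrt (r\<^sup>2)" by (auto simp: singular_values_def)
    then show "r \<in> sqrt ` ?E" by blast
  qed
  have "transpose (transpose A ** A) = transpose A ** A"
    by (simp add: matrix_transpose_mul)
  from finite_eigenvalues_symmetric[OF this] show "finite (sqrt ` ?E)" by simp
qed

lemma inner_transpose_mult:
  fixes A :: "real ^ 'm ^ 'n"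
  shows "((transpose A ** A) *v x) \<bullet> y = (A *v x) \<bullet> (A *v y)"
  by (metis dot_lmul_matrix inner_commute matrix_vector_mul_assoc transpose_matrix_vector)

text \<open>By compactness \<open>norm (A *v x)\<close> has a maximiser \<open>v\<close> on the unit
  sphere, and a variational argument shows that \<open>v\<close> is an eigenvector of
  \<open>transpose A ** A\<close>. So the operator norm is itself a singular value, and the set
  under \<open>Max\<close> is nonempty.\<close>

lemma exists_maximal_singular_value:
  fixes A :: "real ^ 'm ^ 'n"
  obtains r where "r \<in> singular_values A" "\<And>x. norm (A *v x) \<le> r * norm x"
proof -
  have "continuous_on (sphere 0 1) (\<lambda>x. norm (A *v x))"
    by (intro continuous_intros)
  moreover have "sphere (0::real^'m) 1 \<noteq> {}" by simp
  ultimately obtain v where v: "norm v = 1" "\<And>y. norm y = 1 \<Longrightarrow> norm (A *v y) \<le> norm (A *v v)"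
    using continuous_attains_sup[of "sphere (0::real^'m) 1" "\<lambda>x. norm (A *v x)"] by auto
  define r where "r = norm (A *v v)"
  have bound: "norm (A *v x) \<le> r * norm x" for x
  proof (cases "x = 0")
    case False
    then have "norm (A *v ((1 / norm x) *\<^sub>R x)) \<le> r"
      unfolding r_def by (intro v) simp
    then show ?thesis using False
      by (simp add: matrix_vector_mult_scaleR divide_simps mult.commute)
  qed simp
  define w where "w = r\<^sup>2 *\<^sub>R v - (transpose A ** A) *v v"
  text \<open>The form \<open>q x = r\<^sup>2 \<parallel>x\<parallel>\<^sup>2 - \<parallel>A x\<parallel>\<^sup>2\<close> is non-negative and vanishes at \<open>v\<close>, so its half-gradient \<open>w\<close> at \<open>v\<close> vanishes.\<close>
  define c where "c = r\<^sup>2 * (w \<bullet> w) - (A *v w) \<bullet> (A *v w)"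
  have q_nonneg: "r\<^sup>2 * (x \<bullet> x) - (A *v x) \<bullet> (A *v x) \<ge> 0" for x
    using power_mono[OF bound[of x] norm_ge_zero, of 2]
    by (simp add: power_mult_distrib power2_norm_eq_inner)
  \<comment> \<open>This is the form \<open>q\<close> at \<open>v + t *\<^sub>R w\<close>: the
    constant term \<open>q v\<close> vanishes and the linear coefficient is twice
    \<open>w \<bullet> w\<close>.\<close>
  have expand: "2 * t * (w \<bullet> w) + t\<^sup>2 * c \<ge> 0" for t
  proof -
    have "w \<bullet> w = r\<^sup>2 * (v \<bullet> w) - (A *v v) \<bullet> (A *v w)"
      by (subst (1) w_def) (simp add: inner_diff_left inner_transpose_mult)
    moreover have "r\<^sup>2 * (v \<bullet> v) - (A *v v) \<bullet> (A *v v) = 0"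
      using v(1) by (simp add: r_def flip: power2_norm_eq_inner)
    moreover have "r\<^sup>2 * ((v + t *\<^sub>R w) \<bullet> (v + t *\<^sub>R w)) - (A *v (v + t *\<^sub>R w)) \<bullet> (A *v (v + t *\<^sub>R w)) =
      (r\<^sup>2 * (v \<bullet> v) - (A *v v) \<bullet> (A *v v)) + 2 * t * (r\<^sup>2 * (v \<bullet> w) - (A *v v) \<bullet> (A *v w)) + t\<^sup>2 * c"
      unfolding c_def
      by (simp add: matrix_vector_right_distrib matrix_vector_mult_scaleR inner_commute[of w v]
          inner_commute[of "A *v w" "A *v v"] inner_add_left inner_add_right algebra_simps power2_eq_square)
    ultimately show ?thesis using q_nonneg[of "v + t *\<^sub>R w"] by simp
  qed
  have "c \<ge> 0" using q_nonneg c_def by simp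
  have "w \<bullet> w = 0"
  proof (rule ccontr)
    assume "w \<bullet> w \<noteq> 0"
    then have pos: "w \<bullet> w > 0" by simp
    define a where "a = w \<bullet> w"
    \<comment> \<open>A small negative \<open>t\<close> lets the linear term win; the denominator
      \<open>1 + c\<close> also covers \<open>c = 0\<close>.\<close>
    have "2 * (- a / (1 + c)) * a + (- a / (1 + c))\<^sup>2 * c = - (a\<^sup>2 * (2 + c)) / (1 + c)\<^sup>2"
      using \<open>c \<ge> 0\<close> by (simp add: divide_simps) (simp add: algebra_simps power2_eq_square)
    also have "\<dots> < 0" using \<open>c \<ge> 0\<close> pos by (simp add: a_def)
    finally show False using expand[of "- a / (1 + c)"] unfolding a_def by linarith
  qed
  then have "(transpose A ** A) *v v = r\<^sup>2 *\<^sub>R v" by (simp add: w_def)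
  moreover have "v \<noteq> 0" using v(1) by auto
  ultimately have "r \<in> singular_values A"
    unfolding singular_values_def r_def by auto
  with bound show ?thesis using that by blast
qed

lemma max_singular_value_nonneg: "max_singular_value A \<ge> 0"
proof -
  obtain r where "r \<in> singular_values A" using exists_maximal_singular_value by blast
  moreover from this have "r \<le> max_singular_value A"
    by (simp add: max_singular_value_def finite_singular_values)
  ultimately show ?thesis by (auto simp: singular_values_def)
qed

lemma norm_matrix_vector_le_max_singular_value:
  "norm (A *v x) \<le> max_singular_value A * norm x"
proof -
  obtain r where r: "r \<in> singular_values A" "norm (A *v x) \<le> r * norm x"
    using exists_maximal_singular_value by blast
  then have "r \<le> max_singular_value A"
    by (simp add: max_singular_value_def finite_singular_values)
  with r show ?thesis by (meson mult_right_mono norm_ge_zero order_trans)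
qed

text \<open>The bound passes to the transpose: the squared norm of \<open>x v* A\<close> is
  \<open>x \<bullet> (A *v (x v* A))\<close>, and after Cauchy-Schwarz one factor cancels. The rows
  of \<open>X ** W\<close> have this form.\<close>

lemma norm_vector_matrix_le_max_singular_value:
  fixes A :: "real ^ 'm ^ 'n"
  shows "norm (x v* A) \<le> max_singular_value A * norm x"
proof (cases "x v* A = 0")
  case False
  have "norm (x v* A) * norm (x v* A) = x \<bullet> (A *v (x v* A))"
    by (metis dot_lmul_matrix power2_eq_square power2_norm_eq_inner)
  also have "\<dots> \<le> norm x * norm (A *v (x v* A))" by (rule norm_cauchy_schwarz)
  also have "\<dots> \<le> norm x * (max_singular_value A * norm (x v* A))"
    by (intro mult_left_mono norm_matrix_vector_le_max_singular_value) simp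
  finally show ?thesis using False by (simp add: mult.commute mult.left_commute)
qed (simp add: max_singular_value_nonneg)

section \<open>Frobenius norm by rows and columns\<close>

lemma norm_matrix_power2_rows:
  fixes X :: "real ^ 'c ^ 'n"
  shows "(norm X)\<^sup>2 = (\<Sum>n\<in>UNIV. (norm (X $ n))\<^sup>2)"
  by (simp add: norm_vec_def L2_set_def sum_nonneg)

lemma norm_matrix_power2_columns:
  fixes X :: "real ^ 'c ^ 'n"
  shows "(norm X)\<^sup>2 = (\<Sum>c\<in>UNIV. (norm (column c X))\<^sup>2)"
  by (simp add: norm_vec_def L2_set_def sum_nonneg column_def) (rule sum.swap)

lemma norm_matrix_mult_right_le:
  fixes X :: "real ^ 'c ^ 'n" and W :: "real ^ 'd ^ 'c"
  shows "norm (X ** W) \<le> max_singular_value W * norm X"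
proof (rule power2_le_imp_le)
  have row: "(X ** W) $ n = (X $ n) v* W" for n
    by (vector matrix_matrix_mult_def vector_matrix_mult_def mult.commute)
  have "(norm (X ** W))\<^sup>2 \<le> (\<Sum>n\<in>UNIV. (max_singular_value W * norm (X $ n))\<^sup>2)"
    unfolding norm_matrix_power2_rows row
    by (intro sum_mono power_mono norm_vector_matrix_le_max_singular_value) simp
  then show "(norm (X ** W))\<^sup>2 \<le> (max_singular_value W * norm X)\<^sup>2"
    by (simp add: norm_matrix_power2_rows[of X] power_mult_distrib sum_distrib_left)
qed (simp add: max_singular_value_nonneg)

section \<open>Orthogonal projection onto the tensor space\<close>

lemma tensor_add_left: "tensor (u + v) w = tensor u w + tensor v w"
  by (vector tensor_def algebra_simps)

lemma tensor_add_right: "tensor v (w + w') = tensor v w + tensor v w'"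
  by (vector tensor_def algebra_simps)

lemma tensor_scaleR_left: "tensor (a *\<^sub>R v) w = a *\<^sub>R tensor v w"
  by (vector tensor_def algebra_simps)

lemma tensor_scaleR_right: "tensor v (a *\<^sub>R w) = a *\<^sub>R tensor v w"
  by (vector tensor_def algebra_simps)

lemma tensor_zero_left [simp]: "tensor 0 w = 0"
  by (vector tensor_def)

lemma tensor_zero_right [simp]: "tensor v 0 = 0"
  by (vector tensor_def)

lemma matrix_mult_tensor: "P ** tensor v w = tensor (P *v v) w"
  by (simp add: vec_eq_iff tensor_def matrix_matrix_mult_def matrix_vector_mult_def
      sum_distrib_right mult.assoc)

lemma tensor_matrix_mult: "tensor v w ** W = tensor v (w v* W)"
  by (simp add: vec_eq_iff tensor_def matrix_matrix_mult_def vector_matrix_mult_def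
      sum_distrib_left algebra_simps)

lemma vector_matrix_mult_tensor: "u v* tensor v w = (u \<bullet> v) *\<^sub>R w"
  by (simp add: vec_eq_iff tensor_def vector_matrix_mult_def inner_vec_def
      sum_distrib_left sum_distrib_right algebra_simps)

text \<open>The map sending \<open>X\<close> to \<open>v v* X\<close> is the adjoint of
  \<open>tensor v\<close>; orthogonality to tensors thus becomes a condition on row vectors.\<close>

lemma inner_tensor: "tensor v w \<bullet> X = w \<bullet> (v v* X)"
proof -
  have "tensor v w \<bullet> X = (\<Sum>n\<in>UNIV. \<Sum>c\<in>UNIV. v $ n * w $ c * X $ n $ c)"
    by (simp add: tensor_def inner_vec_def)
  also have "\<dots> = (\<Sum>c\<in>UNIV. \<Sum>n\<in>UNIV. v $ n * w $ c * X $ n $ c)" by (rule sum.swap)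
  also have "\<dots> = w \<bullet> (v v* X)"
    by (simp add: inner_vec_def vector_matrix_mult_def sum_distrib_left algebra_simps)
  finally show ?thesis .
qed

lemma linear_vector_matrix_mult: "linear (\<lambda>X :: real ^ 'c ^ 'n. u v* X)"
  by (rule linearI) (simp_all add: vec_eq_iff vector_matrix_mult_def algebra_simps sum.distrib
      sum_distrib_left)

lemma linear_matrix_mult_right:
  fixes P :: "real ^ 'm ^ 'n"
  shows "linear (\<lambda>X. P ** X)"
  by (rule linearI) (simp_all add: vec_eq_iff matrix_matrix_mult_def algebra_simps sum.distrib
      sum_distrib_left)

lemma linear_matrix_mult_left:
  fixes W :: "real ^ 'm ^ 'n"
  shows "linear (\<lambda>X. X ** W)"
  by (rule linearI) (simp_all add: vec_eq_iff matrix_matrix_mult_def algebra_simps sum.distrib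
      sum_distrib_left)

section \<open>The tensor space as an invariant subspace\<close>

lemma tensor_in_tensor_space:
  assumes "m \<in> {1..M}"
  shows "tensor (e m) w \<in> tensor_space M e"
proof -
  have "(\<Sum>k=1..M. tensor (e k) (if k = m then w else 0)) = tensor (e m) w"
    using assms by (simp add: if_distrib[of "tensor _"] cong: if_cong)
  then show ?thesis unfolding tensor_space_def by (auto intro: exI[where x = "\<lambda>k. if k = m then w else 0"])
qed

lemma subspace_tensor_space: "subspace (tensor_space M e :: (real ^ 'c ^ 'n) set)"
proof (rule subspaceI)
  show "0 \<in> tensor_space M e"
    unfolding tensor_space_def by (auto intro!: exI[where x = "\<lambda>_. 0"])
next
  fix x y :: "real ^ 'c ^ 'n" assume "x \<in> tensor_space M e" "y \<in> tensor_space M e"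
  then obtain f g where "x = (\<Sum>m=1..M. tensor (e m) (f m))" "y = (\<Sum>m=1..M. tensor (e m) (g m))"
    unfolding tensor_space_def by auto
  then have "x + y = (\<Sum>m=1..M. tensor (e m) (f m + g m))"
    by (simp add: tensor_add_right sum.distrib)
  then show "x + y \<in> tensor_space M e"
    unfolding tensor_space_def by (auto intro!: exI[where x = "\<lambda>m. f m + g m"])
next
  fix a and x :: "real ^ 'c ^ 'n" assume "x \<in> tensor_space M e"
  then obtain f where "x = (\<Sum>m=1..M. tensor (e m) (f m))"
    unfolding tensor_space_def by auto
  then have "a *\<^sub>R x = (\<Sum>m=1..M. tensor (e m) (a *\<^sub>R f m))"
    by (simp add: tensor_scaleR_right scaleR_sum_right)
  then show "a *\<^sub>R x \<in> tensor_space M e"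
    unfolding tensor_space_def by (auto intro!: exI[where x = "\<lambda>m. a *\<^sub>R f m"])
qed

text \<open>Needed because \<open>P *v e m\<close> is in general a combination of several basis
  vectors.\<close>

lemma tensor_span_in_tensor_space:
  assumes "v \<in> span (e ` {1..M})"
  shows "tensor v w \<in> tensor_space M e"
  using assms
proof (induction rule: span_induct_alt)
  case base
  then show ?case by (simp add: subspace_0 subspace_tensor_space)
next
  case (step c x y)
  then show ?case
    by (auto simp: tensor_add_left tensor_scaleR_left
        intro!: subspace_add subspace_scale subspace_tensor_space tensor_in_tensor_space)
qed

lemma matrix_mult_tensor_space:
  assumes "Y \<in> tensor_space M e" and "\<And>m. m \<in> {1..M} \<Longrightarrow> P *v e m \<in> span (e ` {1..M})"
  shows "P ** Y \<in> tensor_space M e"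
proof -
  obtain w where "Y = (\<Sum>m=1..M. tensor (e m) (w m))"
    using assms(1) unfolding tensor_space_def by auto
  then show ?thesis
    by (auto simp: linear_sum[OF linear_matrix_mult_right] matrix_mult_tensor
        intro!: subspace_sum subspace_tensor_space tensor_span_in_tensor_space assms(2))
qed

lemma tensor_space_matrix_mult:
  assumes "Y \<in> tensor_space M e"
  shows "Y ** W \<in> tensor_space M e"
proof -
  obtain w where "Y = (\<Sum>m=1..M. tensor (e m) (w m))"
    using assms unfolding tensor_space_def by auto
  then show ?thesis
    by (auto simp: linear_sum[OF linear_matrix_mult_left] tensor_matrix_mult
        intro!: subspace_sum subspace_tensor_space tensor_in_tensor_space)
qed

text \<open>For orthonormal \<open>e\<close> this applies the orthogonal projection onto their span
  to every column of \<open>X\<close>.\<close>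

definition tensor_proj :: "nat \<Rightarrow> (nat \<Rightarrow> real ^ 'n) \<Rightarrow> real ^ 'c ^ 'n \<Rightarrow> real ^ 'c ^ 'n" where
  "tensor_proj M e X = (\<Sum>m=1..M. tensor (e m) (e m v* X))"

lemma tensor_proj_in_tensor_space: "tensor_proj M e X \<in> tensor_space M e"
  unfolding tensor_proj_def tensor_space_def by (auto intro!: exI[where x = "\<lambda>m. e m v* X"])

lemma vector_matrix_tensor_proj:
  assumes "orthonormal_basis M e U" "k \<in> {1..M}"
  shows "e k v* tensor_proj M e X = e k v* X"
proof -
  have "e k v* tensor_proj M e X = (\<Sum>m=1..M. (e k \<bullet> e m) *\<^sub>R (e m v* X))"
    by (simp add: tensor_proj_def linear_sum[OF linear_vector_matrix_mult] vector_matrix_mult_tensor)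
  also have "\<dots> = (\<Sum>m=1..M. if k = m then e m v* X else 0)"
    using assms by (intro sum.cong) (auto simp: orthonormal_basis_def)
  finally show ?thesis using assms(2) by simp
qed

text \<open>Every \<open>e k\<close> annihilates the residual by
  \<open>vector_matrix_tensor_proj\<close>, and \<open>inner_tensor\<close> transfers this to
  tensors.\<close>

lemma inner_tensor_space_residual:
  assumes "orthonormal_basis M e U" "Y \<in> tensor_space M e"
  shows "Y \<bullet> (X - tensor_proj M e X) = 0"
proof -
  obtain w where "Y = (\<Sum>m=1..M. tensor (e m) (w m))"
    using assms(2) unfolding tensor_space_def by auto
  then show ?thesis
    by (simp add: inner_sum_left inner_tensor linear_diff[OF linear_vector_matrix_mult]
        vector_matrix_tensor_proj[OF assms(1)])
qed

text \<open>Pythagoras: \<open>X - Y\<close> is the residual plus \<open>?p - Y\<close>, which lies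
  in the tensor space and so is orthogonal to the residual.\<close>

lemma infdist_tensor_space:
  assumes "orthonormal_basis M e U"
  shows "infdist X (tensor_space M e) = norm (X - tensor_proj M e X)"
proof (rule antisym)
  let ?p = "tensor_proj M e X"
  show "infdist X (tensor_space M e) \<le> norm (X - ?p)"
    using infdist_le[OF tensor_proj_in_tensor_space] by (simp add: dist_norm)
  have "norm (X - ?p) \<le> dist X Y" if "Y \<in> tensor_space M e" for Y
  proof (rule power2_le_imp_le)
    have "(?p - Y) \<bullet> (X - ?p) = 0"
      by (intro inner_tensor_space_residual[OF assms] subspace_diff subspace_tensor_space
          tensor_proj_in_tensor_space that)
    then have "(norm ((X - ?p) + (?p - Y)))\<^sup>2 = (norm (X - ?p))\<^sup>2 + (norm (?p - Y))\<^sup>2"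
      by (intro norm_add_Pythagorean) (simp add: orthogonal_def inner_commute)
    then show "(norm (X - ?p))\<^sup>2 \<le> (dist X Y)\<^sup>2" by (simp add: dist_norm)
  qed simp
  moreover have "tensor_space M e \<noteq> {}" using tensor_proj_in_tensor_space by blast
  ultimately show "norm (X - ?p) \<le> infdist X (tensor_space M e)"
    by (metis (no_types, lifting) cINF_greatest infdist_notempty)
qed

text \<open>Replaces the projection by the vectors \<open>e m v* X\<close>, on which the signs
  needed for ReLU are visible.\<close>

lemma infdist_tensor_space_power2:
  assumes "orthonormal_basis M e U"
  shows "(infdist X (tensor_space M e))\<^sup>2 = (norm X)\<^sup>2 - (\<Sum>m=1..M. (norm (e m v* X))\<^sup>2)"
proof -
  let ?p = "tensor_proj M e X"
  have "?p \<bullet> (X - ?p) = 0"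
    by (intro inner_tensor_space_residual[OF assms] tensor_proj_in_tensor_space)
  then have "(norm (X - ?p))\<^sup>2 = (norm X)\<^sup>2 - ?p \<bullet> X"
    by (simp add: power2_norm_eq_inner inner_diff_left inner_diff_right inner_commute)
  moreover have "?p \<bullet> X = (\<Sum>m=1..M. (norm (e m v* X))\<^sup>2)"
    by (simp add: tensor_proj_def inner_sum_left inner_tensor power2_norm_eq_inner)
  ultimately show ?thesis by (simp add: infdist_tensor_space[OF assms])
qed

section \<open>Contraction of the distance\<close>

lemma infdist_tensor_space_relu_le:
  assumes basis: "orthonormal_basis M e U" and nonneg: "\<forall>m\<in>{1..M}. nonneg_vec (e m)"
  shows "infdist (relu X) (tensor_space M e) \<le> infdist X (tensor_space M e)"
proof (rule power2_le_imp_le)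
  \<comment> \<open>\<open>Z\<close> is the negative part of \<open>X\<close>; its entries are
    nonnegative.\<close>
  define Z where "Z = relu X - X"
  have X: "X = relu X - Z" by (simp add: Z_def)
  \<comment> \<open>In each entry one of the two factors vanishes.\<close>
  have "relu X \<bullet> Z = 0"
    by (auto simp: Z_def relu_def inner_vec_def max_def intro!: sum.neutral)
  then have norm_X: "(norm X)\<^sup>2 = (norm (relu X))\<^sup>2 + (norm Z)\<^sup>2"
    by (subst X) (simp add: power2_norm_eq_inner inner_diff_left inner_diff_right inner_commute)
  have inner_X: "(norm (e m v* X))\<^sup>2 \<le> (norm (e m v* relu X))\<^sup>2 + (norm (e m v* Z))\<^sup>2"
    if "m \<in> {1..M}" for m
  proof -
    have "(e m v* relu X) \<bullet> (e m v* Z) \<ge> 0"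
      using nonneg that
      by (auto simp: inner_vec_def vector_matrix_mult_def nonneg_vec_def Z_def relu_def
          intro!: sum_nonneg mult_nonneg_nonneg)
    moreover have "e m v* X = e m v* relu X - e m v* Z"
      by (subst X) (simp add: linear_diff[OF linear_vector_matrix_mult])
    ultimately show ?thesis
      by (simp add: power2_norm_eq_inner inner_diff_left inner_diff_right inner_commute)
  qed
  have "(\<Sum>m=1..M. (norm (e m v* X))\<^sup>2)
      \<le> (\<Sum>m=1..M. (norm (e m v* relu X))\<^sup>2 + (norm (e m v* Z))\<^sup>2)"
    by (intro sum_mono inner_X)
  \<comment> \<open>Expanded by \<open>infdist_tensor_space_power2\<close>, this is Bessel's
    inequality for \<open>Z\<close>.\<close>
  moreover have "0 \<le> (infdist Z (tensor_space M e))\<^sup>2" by simp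
  ultimately show "(infdist (relu X) (tensor_space M e))\<^sup>2 \<le> (infdist X (tensor_space M e))\<^sup>2"
    using norm_X by (simp add: infdist_tensor_space_power2[OF basis] sum.distrib)
qed (rule infdist_nonneg)

text \<open>The projection of \<open>X\<close> times \<open>W\<close> stays in the tensor space, so
  it is a competitor for the infimum.\<close>

lemma infdist_tensor_space_mult_right_le:
  assumes "orthonormal_basis M e U"
  shows "infdist (X ** W) (tensor_space M e) \<le> max_singular_value W * infdist X (tensor_space M e)"
proof -
  let ?p = "tensor_proj M e X"
  have "infdist (X ** W) (tensor_space M e) \<le> norm (X ** W - ?p ** W)"
    using infdist_le[OF tensor_space_matrix_mult[OF tensor_proj_in_tensor_space]]
    by (simp add: dist_norm)
  also have "X ** W - ?p ** W = (X - ?p) ** W" by (simp add: linear_diff[OF linear_matrix_mult_left])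
  also have "norm \<dots> \<le> max_singular_value W * norm (X - ?p)" by (rule norm_matrix_mult_right_le)
  finally show ?thesis by (simp add: infdist_tensor_space[OF assms])
qed

text \<open>Without this bound, here \<open>onorm f\<close>, the real supremum in
  \<open>onorm_on\<close> need not dominate its ratios.\<close>

lemma bdd_above_onorm_on: 
  fixes f :: "'a::real_normed_vector \<Rightarrow> 'b::real_normed_vector"
  assumes "bounded_linear f"
  shows "bdd_above ((\<lambda>x. norm (f x) / norm x) ` S)"
  using le_onorm[OF assms] by (auto intro!: bdd_aboveI)

lemma norm_le_onorm_on:
  assumes "bounded_linear f" "x \<in> S"
  shows "norm (f x) \<le> onorm_on S f * norm x"
proof (cases "x = 0")
  case True
  then show ?thesis using assms(1) by (simp add: linear_simps)
next
  case False
  have "norm (f x) / norm x \<le> onorm_on S f"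
    unfolding onorm_on_def by (rule cSUP_upper[OF assms(2) bdd_above_onorm_on[OF assms(1)]])
  then show ?thesis using False by (simp add: divide_simps)
qed

lemma onorm_on_nonneg:
  assumes "bounded_linear f" "x \<in> S"
  shows "onorm_on S f \<ge> 0"
proof -
  have "norm (f x) / norm x \<le> onorm_on S f"
    unfolding onorm_on_def by (rule cSUP_upper[OF assms(2) bdd_above_onorm_on[OF assms(1)]])
  then show ?thesis by (rule order_trans[rotated]) simp
qed

lemma infdist_tensor_space_mult_left_le:
  assumes basis: "orthonormal_basis M e U" and invariant: "\<forall>x\<in>U. P *v x \<in> U"
  shows "infdist (P ** X) (tensor_space M e)
    \<le> onorm_on (orthogonal_comp U) (\<lambda>x. P *v x) * infdist X (tensor_space M e)"
proof -
  let ?p = "tensor_proj M e X" and ?lam = "onorm_on (orthogonal_comp U) (\<lambda>x. P *v x)"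
  define D where "D = X - ?p"
  have U: "U = span (e ` {1..M})" using basis by (simp add: orthonormal_basis_def)
  have lin: "bounded_linear (\<lambda>x. P *v x)" by (rule matrix_vector_mul_bounded_linear)
  \<comment> \<open>This is what allows the norm of \<open>P\<close> restricted to the complement to
    be used column by column.\<close>
  have col: "column c D \<in> orthogonal_comp U" for c
  proof -
    have "e m \<bullet> column c D = (e m v* D) $ c" for m
      by (simp add: inner_vec_def column_def vector_matrix_mult_def mult.commute)
    then have "orthogonal (column c D) x" if "x \<in> e ` {1..M}" for x
      using that
      by (auto simp: D_def linear_diff[OF linear_vector_matrix_mult] orthogonal_def inner_commute
          vector_matrix_tensor_proj[OF basis])
    then show ?thesis
      by (simp add: U orthogonal_comp_def orthogonal_commute[of _ "column c D"] orthogonal_to_span)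
  qed
  have lam_nonneg: "?lam \<ge> 0" using onorm_on_nonneg[OF lin col] .
  \<comment> \<open>Invariance of \<open>U\<close> makes \<open>P ** ?p\<close> a competitor for the
    infimum.\<close>
  have "P ** ?p \<in> tensor_space M e"
    using invariant by (intro matrix_mult_tensor_space tensor_proj_in_tensor_space)
      (simp_all add: U span_base)
  then have "infdist (P ** X) (tensor_space M e) \<le> norm (P ** X - P ** ?p)"
    using infdist_le by (metis dist_norm)
  also have "P ** X - P ** ?p = P ** D" by (simp add: D_def linear_diff[OF linear_matrix_mult_right])
  also have "norm \<dots> \<le> ?lam * norm D"
  proof (rule power2_le_imp_le)
    have "column c (P ** D) = P *v column c D" for c
      by (simp add: vec_eq_iff column_def matrix_matrix_mult_def matrix_vector_mult_def)
    then have "(norm (P ** D))\<^sup>2 \<le> (\<Sum>c\<in>UNIV. (?lam * norm (column c D))\<^sup>2)"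
      unfolding norm_matrix_power2_columns[of "P ** D"]
      by (auto intro!: sum_mono power_mono norm_le_onorm_on[OF lin col])
    then show "(norm (P ** D))\<^sup>2 \<le> (?lam * norm D)\<^sup>2"
      by (simp add: norm_matrix_power2_columns[of D] power_mult_distrib sum_distrib_left)
  qed (simp add: lam_nonneg)
  finally show ?thesis by (simp add: infdist_tensor_space[OF basis] D_def)
qed

lemma infdist_tensor_space_mlp_le:
  assumes "orthonormal_basis M e U" "\<forall>m\<in>{1..M}. nonneg_vec (e m)"
  shows "infdist (mlp W h X) (tensor_space M e)
    \<le> (\<Prod>i=1..h. max_singular_value (W i)) * infdist X (tensor_space M e)"
proof (induction h)
  case 0
  \<comment> \<open>The product is empty here, but \<open>mlp\<close> still applies one
    ReLU.\<close>
  then show ?case using infdist_tensor_space_relu_le[OF assms] by simp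
next
  case (Suc h)
  have "infdist (mlp W (Suc h) X) (tensor_space M e)
      \<le> infdist (mlp W h X ** W (Suc h)) (tensor_space M e)"
    using infdist_tensor_space_relu_le[OF assms] by simp
  also have "\<dots> \<le> max_singular_value (W (Suc h)) * infdist (mlp W h X) (tensor_space M e)"
    by (rule infdist_tensor_space_mult_right_le[OF assms(1)])
  also have "\<dots> \<le> max_singular_value (W (Suc h)) *
      ((\<Prod>i=1..h. max_singular_value (W i)) * infdist X (tensor_space M e))"
    by (intro mult_left_mono Suc.IH max_singular_value_nonneg)
  finally show ?case by (simp add: algebra_simps)
qed

theorem corollary2:
  fixes P :: "real ^ 'n ^ 'n"
    and U :: "(real ^ 'n) set"
    and M :: nat
    and e :: "nat \<Rightarrow> real ^ 'n"
    and H :: "nat \<Rightarrow> nat"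
    and W :: "nat \<Rightarrow> nat \<Rightarrow> real ^ 'c ^ 'c"
    and sl :: "nat \<Rightarrow> real"
    and s lam :: real
  assumes P_sym: "transpose P = P"
    and U_subspace: "subspace U" "dim U = M" "M \<le> CARD('n)"
    and e_basis: "orthonormal_basis M e U"
    and e_nonneg: "\<forall>m\<in>{1..M}. nonneg_vec (e m)"
    and U_invariant: "\<forall>x\<in>U. P *v x \<in> U"
    and lam: "lam = onorm_on (orthogonal_comp U) (\<lambda>x. P *v x)"
    and H_pos: "\<forall>l\<ge>1. H l \<ge> 1"
    and sl: "\<forall>l\<ge>1. sl l = (\<Prod>h=1..H l. max_singular_value (W l h))"
    and s_finite: "bdd_above (sl ` {1..})"
    and s: "s = (SUP l\<in>{1..}. sl l)"
  shows "(\<forall>X0 :: real ^ 'c ^ 'n.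
            (\<lambda>l. infdist (layer_output P H W X0 l) (tensor_space M e)) \<in> O(\<lambda>l. (s * lam) ^ l)) \<and>
         (s * lam < 1 \<longrightarrow>
           (\<forall>X0 :: real ^ 'c ^ 'n.
              exponentially_approaches (layer_output P H W X0) (tensor_space M e)))"
proof -
  let ?d = "\<lambda>X :: real ^ 'c ^ 'n. infdist X (tensor_space M e)"
  \<comment> \<open>The ratio at \<open>0\<close> is \<open>0\<close>, and \<open>0\<close> lies in
    every orthogonal complement, so a trivial complement causes no trouble.\<close>
  have lam_nonneg: "lam \<ge> 0"
    unfolding lam by (rule onorm_on_nonneg[of _ 0]) (auto simp: orthogonal_comp_def orthogonal_def)
  have sl_nonneg: "sl l \<ge> 0" if "l \<ge> 1" for l
    using that sl by (simp add: prod_nonneg max_singular_value_nonneg)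
  have sl_le: "sl l \<le> s" if "l \<ge> 1" for l
    unfolding s using that by (intro cSUP_upper s_finite) simp
  have s_nonneg: "s \<ge> 0" using sl_nonneg[of 1] sl_le[of 1] by simp
  then have q_nonneg: "s * lam \<ge> 0" using lam_nonneg by simp
  have step: "?d (layer P H W l X) \<le> s * lam * ?d X" if "l \<ge> 1" for l X
  proof -
    have "?d (layer P H W l X) \<le> sl l * ?d (P ** X)"
      using infdist_tensor_space_mlp_le[OF e_basis e_nonneg, of "W l" "H l" "P ** X"] sl that
      by (simp add: layer_def)
    also have "\<dots> \<le> s * (lam * ?d X)"
      using infdist_tensor_space_mult_left_le[OF e_basis U_invariant, of X] sl_le[OF that] s_nonneg
      by (intro mult_mono infdist_nonneg) (simp_all add: lam)
    finally show ?thesis by (simp add: mult.assoc)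
  qed
  have bound: "?d (layer_output P H W X0 l) \<le> ?d X0 * (s * lam) ^ l" for X0 l
  proof (induction l)
    case (Suc l)
    have "?d (layer_output P H W X0 (Suc l)) \<le> s * lam * ?d (layer_output P H W X0 l)"
      using step[of "Suc l"] by simp
    also have "\<dots> \<le> s * lam * (?d X0 * (s * lam) ^ l)"
      by (intro mult_left_mono Suc.IH q_nonneg)
    finally show ?case by (simp add: mult.left_commute)
  qed simp
  \<comment> \<open>A free \<rho> serves both claims: \<rho> equal to \<open>s * lam\<close> for the
    growth bound, and a possibly larger rate for exponential approach.\<close>
  have bigo: "(\<lambda>l. ?d (layer_output P H W X0 l)) \<in> O(\<lambda>l. \<rho> ^ l)" if "s * lam \<le> \<rho>" for X0 \<rho>
  proof (rule bigoI[where c = "?d X0"], rule always_eventually, rule allI)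
    fix l
    have "?d X0 * (s * lam) ^ l \<le> ?d X0 * \<rho> ^ l"
      using that q_nonneg by (intro mult_left_mono power_mono infdist_nonneg)
    then show "norm (?d (layer_output P H W X0 l)) \<le> ?d X0 * norm (\<rho> ^ l)"
      using bound[of X0 l] that q_nonneg by (simp add: infdist_nonneg)
  qed
  have "exponentially_approaches (layer_output P H W X0) (tensor_space M e)" if "s * lam < 1" for X0
    unfolding exponentially_approaches_def
    \<comment> \<open>\<open>s * lam\<close> itself may be \<open>0\<close>, but the rate has to be positive.\<close>
    using that bigo[of "max (s * lam) (1/2)"] by (intro exI[of _ "max (s * lam) (1/2)"]) auto
  then show ?thesis using bigo by blast
qed

end
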